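(* Let $S=\langle U,\iota\rangle$, $U=\{u_1,\dots,u_n\}$, be a $3$-valued structure that is an image of canonical abstraction (ICA), and let $\mathit{node}^S_u(w):=\bigwedge_{p\in\mathcal{P}_1}p^{\iota(p)(u)}(w)$. Let $$\xi^S := \bigwedge_{i=1}^n \exists v.\,\mathit{node}^S_{u_i}(v)\ \wedge\ \forall w.\bigvee_{i=1}^n\mathit{node}^S_{u_i}(w)\ \wedge\ \bigwedge_{p\in\mathcal{P}_0}p^{\iota(p)()}\ \wedge\ \bigwedge_{r=1}^{\mathit{maxR}}\bigwedge_{p\in\mathcal{P}_r}\forall w_1,\dots,w_r.\bigwedge_{(u'_1,\dots,u'_r)\in U^r}\Big(\bigwedge_{j=1}^r\mathit{node}^S_{u'_j}(w_j)\Rightarrow p^{\iota(p)(u'_1,\dots,u'_r)}(w_1,\dots,w_r)\Big),$$ for each $p\in\mathcal{P}_r$ let $$\tau^S[p]:=\bigwedge_{(u'_1,\dots,u'_r)\in U^r:\ \iota(p)(u'_1,\dots,u'_r)=1/2}\Big(\exists w_1,\dots,w_r.\bigwedge_{j=1}^r\mathit{node}^S_{u'_j}(w_j)\wedge p(w_1,\dots,w_r)\ \wedge\ \exists w_1,\dots,w_r.\bigwedge_{j=1}^r\mathit{node}^S_{u'_j}(w_j)\wedge\neg p(w_1,\dots,w_r)\Big),$$ $\tau^S:=\xi^S\wedge\bigwedge_{r=2}^{\mathit{maxR}}\bigwedge_{p\in\mathcal{P}_r}\tau^S[p]$, and $\widehat{\gamma}_c(S):=F\wedge\tau^S$. Then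 for every $2$-valued structure $S^\natural$: $S^\natural\in\gamma_c(S)$ iff $S^\natural\models\widehat{\gamma}_c(S)$.
   Context: Fix a finite vocabulary $\mathcal{P}$ of predicate symbols containing a designated binary symbol $eq$; $\mathcal{P}_i$ denotes the symbols of arity $i$, $\mathit{maxR}$ the maximal arity. Formulas are those of first-order logic with transitive closure over $\mathcal{P}$ (standard semantics); fix a closed formula $F$ (the integrity formula). A $2$-valued structure is $S=\langle U,\iota\rangle$ with $\iota(p):U^i\to\{0,1\}$, $\iota(eq)$ being equality; a $3$-valued structure allows values in $\{0,1,1/2\}$, with $\iota(eq)(u,u)\in\{1,1/2\}$ and $\iota(eq)(u_1,u_2)=0$ for distinct nodes. The join of a nonempty set of truth values is their common value if all are equal, else $1/2$. Canonical abstraction of a $2$-valued $S^\natural$: each node $u$ is mapped to its canonical name $\beta(u)=u_{A,B}$, $A=\{p\in\mathcal{P}_1:\iota(p)(u)=1\}$, $B=\{p\in\mathcal{P}_1:\iota(p)(u)=0\}$; the canonical abstraction has node set $\beta(U^{S^\natural})$ and $\iota(p)(u'_1,\dots,u'_k)$ equal to the join of $\iota^{S^\natural}(p)(u_1,\dots,u_k)$ over all $u_i$ with $\beta(u_i)=u'_i$. $S$ is an ICA if it is the canonical abstraction of some $2$-valued structure. For a set $X$ of ICA structures, $\gamma_c(X)$ is the set of $2$-valued $S^\natural$ with $S^\natural\models F$ whose canonical abstraction is some $S\in X$; $\gamma_c(S):=\gamma_c(\{S\})$. For a $k$-ary $p$ and $B\in\{0,1,1/2\}$: $p^0(\bar v):=\neg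 p(\bar v)$, $p^1(\bar v):=p(\bar v)$, $p^{1/2}(\bar v):=\mathit{true}$. *)

theory Defs
  imports Complex_Main "HOL-Library.FuncSet"
begin

text \<open>A finite vocabulary is a finite type of predicate symbols; the type class fixes the arities
  and the designated binary equality symbol.\<close>

class vocabulary = finite +
  fixes arity :: "'a \<Rightarrow> nat"
    and eq_pred :: 'a
  assumes arity_eq_pred: "arity eq_pred = 2"

definition preds :: "nat \<Rightarrow> 'p::vocabulary set" where
  "preds i = {p. arity p = i}"

definition maxR :: "'p::vocabulary itself \<Rightarrow> nat" where
  "maxR _ = Max (range (arity :: 'p \<Rightarrow> nat))"


section \<open>Formulas of first-order logic with transitive closure\<close>

type_synonym var = nat

text \<open>\<open>TC v1 v2 \<phi> v3 v4\<close> is the formula usually written (TC v1,v2: \<phi>)(v3,v4).\<close>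

datatype 'p fm =
    TrueF
  | FalseF
  | Atom 'p "var list"
  | Neg "'p fm"
  | Conj "'p fm" "'p fm"
  | Disj "'p fm" "'p fm"
  | Imp "'p fm" "'p fm"
  | Ex var "'p fm"
  | All var "'p fm"
  | TC var var "'p fm" var var

primrec wf_fm :: "'p::vocabulary fm \<Rightarrow> bool" where
  "wf_fm TrueF = True"
| "wf_fm FalseF = True"
| "wf_fm (Atom p vs) = (length vs = arity p)"
| "wf_fm (Neg \<phi>) = wf_fm \<phi>"
| "wf_fm (Conj \<phi> \<psi>) = (wf_fm \<phi> \<and> wf_fm \<psi>)"
| "wf_fm (Disj \<phi> \<psi>) = (wf_fm \<phi> \<and> wf_fm \<psi>)"
| "wf_fm (Imp \<phi> \<psi>) = (wf_fm \<phi> \<and> wf_fm \<psi>)"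
| "wf_fm (Ex v \<phi>) = wf_fm \<phi>"
| "wf_fm (All v \<phi>) = wf_fm \<phi>"
| "wf_fm (TC v1 v2 \<phi> v3 v4) = (v1 \<noteq> v2 \<and> wf_fm \<phi>)"

primrec fv :: "'p fm \<Rightarrow> var set" where
  "fv TrueF = {}"
| "fv FalseF = {}"
| "fv (Atom p vs) = set vs"
| "fv (Neg \<phi>) = fv \<phi>"
| "fv (Conj \<phi> \<psi>) = fv \<phi> \<union> fv \<psi>"
| "fv (Disj \<phi> \<psi>) = fv \<phi> \<union> fv \<psi>"
| "fv (Imp \<phi> \<psi>) = fv \<phi> \<union> fv \<psi>"
| "fv (Ex v \<phi>) = fv \<phi> - {v}"
| "fv (All v \<phi>) = fv \<phi> - {v}"
| "fv (TC v1 v2 \<phi> v3 v4) = (fv \<phi> - {v1, v2}) \<union> {v3, v4}"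

definition closed_fm :: "'p::vocabulary fm \<Rightarrow> bool" where
  "closed_fm \<phi> \<longleftrightarrow> wf_fm \<phi> \<and> fv \<phi> = {}"


section \<open>Structures\<close>

datatype tv = TV0 | TV1 | TVhalf

record ('p, 'u) struct =
  univ :: "'u set"
  interp :: "'p \<Rightarrow> 'u list \<Rightarrow> tv"

definition tuples :: "'u set \<Rightarrow> nat \<Rightarrow> 'u list set" where
  "tuples U k = {us. length us = k \<and> set us \<subseteq> U}"

text \<open>Interpretations are extensional functions on \<open>U\<^sup>k\<close>, so that equality of records
  is equality of structures.\<close>

definition two_valued :: "('p::vocabulary, 'u) struct \<Rightarrow> bool" where
  "two_valued S \<longleftrightarrow>
     (\<forall>p. interp S p \<in> tuples (univ S) (arity p) \<rightarrow>\<^sub>E {TV0, TV1}) \<and>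
     (\<forall>u1\<in>univ S. \<forall>u2\<in>univ S. interp S eq_pred [u1, u2] = (if u1 = u2 then TV1 else TV0))"

definition three_valued :: "('p::vocabulary, 'u) struct \<Rightarrow> bool" where
  "three_valued S \<longleftrightarrow>
     (\<forall>p. interp S p \<in> tuples (univ S) (arity p) \<rightarrow>\<^sub>E {TV0, TV1, TVhalf}) \<and>
     (\<forall>u\<in>univ S. interp S eq_pred [u, u] \<in> {TV1, TVhalf}) \<and>
     (\<forall>u1\<in>univ S. \<forall>u2\<in>univ S. u1 \<noteq> u2 \<longrightarrow> interp S eq_pred [u1, u2] = TV0)"

text \<open>Satisfaction in a 2-valued structure; transitive closure is not reflexive.\<close>

primrec sat :: "('p, 'u) struct \<Rightarrow> (var \<Rightarrow> 'u) \<Rightarrow> 'p fm \<Rightarrow> bool" where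
  "sat S Z TrueF = True"
| "sat S Z FalseF = False"
| "sat S Z (Atom p vs) = (interp S p (map Z vs) = TV1)"
| "sat S Z (Neg \<phi>) = (\<not> sat S Z \<phi>)"
| "sat S Z (Conj \<phi> \<psi>) = (sat S Z \<phi> \<and> sat S Z \<psi>)"
| "sat S Z (Disj \<phi> \<psi>) = (sat S Z \<phi> \<or> sat S Z \<psi>)"
| "sat S Z (Imp \<phi> \<psi>) = (sat S Z \<phi> \<longrightarrow> sat S Z \<psi>)"
| "sat S Z (Ex v \<phi>) = (\<exists>a\<in>univ S. sat S (Z(v := a)) \<phi>)"
| "sat S Z (All v \<phi>) = (\<forall>a\<in>univ S. sat S (Z(v := a)) \<phi>)"
| "sat S Z (TC v1 v2 \<phi> v3 v4) =
     (\<lambda>a b. a \<in> univ S \<and> b \<in> univ S \<and> sat S (Z(v1 := a, v2 := b)) \<phi>)\<^sup>+\<^sup>+ (Z v3) (Z v4)"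

text \<open>Used for closed formulas only, whose value does not depend on \<open>Z\<close>. Assignments are not
  restricted to the universe, so that the notion is also right for the empty universe.\<close>

definition models :: "('p, 'u) struct \<Rightarrow> 'p fm \<Rightarrow> bool" (infix \<open>\<Turnstile>\<close> 50) where
  "S \<Turnstile> \<phi> \<longleftrightarrow> (\<forall>Z. sat S Z \<phi>)"


section \<open>Canonical abstraction\<close>

definition join :: "tv set \<Rightarrow> tv" where
  "join X = (if is_singleton X then the_elem X else TVhalf)"

text \<open>The canonical name \<open>u\<^bsub>A,B\<^esub>\<close> is the pair \<open>(A, B)\<close>.\<close>

type_synonym 'p cname = "'p set \<times> 'p set"

definition canon_name :: "('p::vocabulary, 'u) struct \<Rightarrow> 'u \<Rightarrow> 'p cname" where
  "canon_name S u =
     ({p \<in> preds 1. interp S p [u] = TV1}, {p \<in> preds 1. interp S p [u] = TV0})"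

definition canon_abs :: "('p::vocabulary, 'u) struct \<Rightarrow> ('p, 'p cname) struct" where
  "canon_abs S =
     \<lparr>univ = canon_name S ` univ S,
      interp = (\<lambda>p. \<lambda>us' \<in> tuples (canon_name S ` univ S) (arity p).
        join {interp S p us | us. us \<in> tuples (univ S) (arity p) \<and> map (canon_name S) us = us'})\<rparr>"

text \<open>HOL cannot quantify existentially over types, so the node type \<open>'u\<close> of the 2-valued
  structure being abstracted is a parameter.\<close>

definition ICA :: "'u itself \<Rightarrow> ('p::vocabulary, 'p cname) struct \<Rightarrow> bool" where
  "ICA _ S \<longleftrightarrow> (\<exists>N :: ('p, 'u) struct. two_valued N \<and> canon_abs N = S)"

definition gamma_c ::
  "'p::vocabulary fm \<Rightarrow> ('p, 'p cname) struct set \<Rightarrow> ('p, 'u) struct set" where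
  "gamma_c F X = {N. two_valued N \<and> N \<Turnstile> F \<and> canon_abs N \<in> X}"


section \<open>The characteristic formula\<close>

text \<open>Finite conjunctions and disjunctions are formed along an arbitrary enumeration of the
  index set.\<close>

definition enum_list :: "'a set \<Rightarrow> 'a list" where
  "enum_list A = (SOME xs. distinct xs \<and> set xs = A)"

definition BigConj :: "'a set \<Rightarrow> ('a \<Rightarrow> 'p fm) \<Rightarrow> 'p fm" where
  "BigConj A f = foldr Conj (map f (enum_list A)) TrueF"

definition BigDisj :: "'a set \<Rightarrow> ('a \<Rightarrow> 'p fm) \<Rightarrow> 'p fm" where
  "BigDisj A f = foldr Disj (map f (enum_list A)) FalseF"

text \<open>The variables \<open>w\<^sub>1, \<dots>, w\<^sub>r\<close> are numbered \<open>0, \<dots>, r - 1\<close>.\<close>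

definition Alls :: "nat \<Rightarrow> 'p fm \<Rightarrow> 'p fm" where
  "Alls r \<phi> = foldr All [0..<r] \<phi>"

definition Exs :: "nat \<Rightarrow> 'p fm \<Rightarrow> 'p fm" where
  "Exs r \<phi> = foldr Ex [0..<r] \<phi>"

primrec lit :: "'p \<Rightarrow> tv \<Rightarrow> var list \<Rightarrow> 'p fm" where
  "lit p TV0 vs = Neg (Atom p vs)"
| "lit p TV1 vs = Atom p vs"
| "lit p TVhalf vs = TrueF"

definition node_fm :: "('p::vocabulary, 'u) struct \<Rightarrow> 'u \<Rightarrow> var \<Rightarrow> 'p fm" where
  "node_fm S u w = BigConj (preds 1) (\<lambda>p. lit p (interp S p [u]) [w])"

definition nodes_fm :: "('p::vocabulary, 'u) struct \<Rightarrow> 'u list \<Rightarrow> 'p fm" where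
  "nodes_fm S us = BigConj {..<length us} (\<lambda>j. node_fm S (us ! j) j)"

definition xi :: "('p::vocabulary, 'u) struct \<Rightarrow> 'p fm" where
  "xi S =
     Conj (BigConj (univ S) (\<lambda>u. Ex 0 (node_fm S u 0)))
    (Conj (All 0 (BigDisj (univ S) (\<lambda>u. node_fm S u 0)))
    (Conj (BigConj (preds 0) (\<lambda>p. lit p (interp S p []) []))
          (BigConj {1..maxR TYPE('p)} (\<lambda>r. BigConj (preds r) (\<lambda>p.
             Alls r (BigConj (tuples (univ S) r) (\<lambda>us.
               Imp (nodes_fm S us) (lit p (interp S p us) [0..<r]))))))))"

definition tau_pred :: "('p::vocabulary, 'u) struct \<Rightarrow> 'p \<Rightarrow> 'p fm" where
  "tau_pred S p =
     (let r = arity p in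
      BigConj {us \<in> tuples (univ S) r. interp S p us = TVhalf} (\<lambda>us.
        Conj (Exs r (Conj (nodes_fm S us) (Atom p [0..<r])))
             (Exs r (Conj (nodes_fm S us) (Neg (Atom p [0..<r]))))))"

definition tau :: "('p::vocabulary, 'u) struct \<Rightarrow> 'p fm" where
  "tau S = Conj (xi S) (BigConj {2..maxR TYPE('p)} (\<lambda>r. BigConj (preds r) (tau_pred S)))"

definition gamma_hat :: "'p::vocabulary fm \<Rightarrow> ('p, 'u) struct \<Rightarrow> 'p fm" where
  "gamma_hat F S = Conj F (tau S)"

end

theory Submission imports Defs begin

text \<open>
  In an image of canonical abstraction every unary predicate is definite at every node, and a node
  is determined by these values. Hence \<open>node\<^sub>u(w)\<close> holds in a 2-valued structure exactly when
  \<open>u\<close> is the canonical name of \<open>w\<close>. Under this reading the first two conjuncts of \<open>\<xi>\<close>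
  say that the abstraction has the right node set, the others that its definite predicate values
  are right, and \<open>\<tau>\<close> adds that each value \<open>1/2\<close> is the join of two distinct values. At arity
  below 2 no value is \<open>1/2\<close>, so \<open>\<tau>\<close> need not mention it.
\<close>

section \<open>Satisfaction of iterated connectives and quantifiers\<close>

lemma set_enum_list:
  assumes "finite A"
  shows "set (enum_list A) = A"
proof -
  have "\<exists>xs. distinct xs \<and> set xs = A"
    using finite_distinct_list[OF assms] by blast
  then show ?thesis
    unfolding enum_list_def by (rule someI2_ex) simp
qed

lemma sat_BigConj:
  assumes "finite A"
  shows "sat S Z (BigConj A f) \<longleftrightarrow> (\<forall>x\<in>A. sat S Z (f x))"
proof -
  have "sat S Z (foldr Conj (map f xs) TrueF) \<longleftrightarrow> (\<forall>x\<in>set xs. sat S Z (f x))" for xs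
    by (induction xs) auto
  then show ?thesis
    using set_enum_list[OF assms] by (simp add: BigConj_def)
qed

lemma sat_BigDisj:
  assumes "finite A"
  shows "sat S Z (BigDisj A f) \<longleftrightarrow> (\<exists>x\<in>A. sat S Z (f x))"
proof -
  have "sat S Z (foldr Disj (map f xs) FalseF) \<longleftrightarrow> (\<exists>x\<in>set xs. sat S Z (f x))" for xs
    by (induction xs) auto
  then show ?thesis
    using set_enum_list[OF assms] by (simp add: BigDisj_def)
qed

text \<open>One simultaneous update stands for the chain of updates left by \<open>r\<close> nested
  quantifiers: these bind \<open>0\<close>, ..., \<open>r - 1\<close>, so a list indexed from 0
  holds all values.\<close>

definition assign :: "(var \<Rightarrow> 'u) \<Rightarrow> 'u list \<Rightarrow> var \<Rightarrow> 'u" where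
  "assign Z ws = (\<lambda>i. if i < length ws then ws ! i else Z i)"

lemma map_assign [simp]: "length ws = r \<Longrightarrow> map (assign Z ws) [0..<r] = ws"
  by (auto simp: assign_def intro: nth_equalityI)

lemma assign_snoc: "assign Z (ws @ [a]) = (assign Z ws)(length ws := a)"
  by (auto simp: assign_def nth_append fun_eq_iff)

lemma tuples_0 [simp]: "tuples U 0 = {[]}"
  by (auto simp: tuples_def)

text \<open>The new entry is appended at the end because \<open>[0..<Suc r]\<close> ends in
  \<open>r\<close>, so the additional quantifier of \<open>Alls\<close> is the innermost
  one.\<close>

lemma tuples_Suc: "tuples U (Suc r) = {ws @ [a] | ws a. ws \<in> tuples U r \<and> a \<in> U}"
proof -
  have "\<exists>ws a. us = ws @ [a] \<and> length ws = r \<and> set ws \<subseteq> U \<and> a \<in> U"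
    if "length us = Suc r" "set us \<subseteq> U" for us
    using that by (cases us rule: rev_cases) auto
  then show ?thesis
    by (auto simp: tuples_def)
qed

lemma finite_tuples: "finite U \<Longrightarrow> finite (tuples U r)"
  using finite_lists_length_eq[of U r] by (simp add: tuples_def conj_commute)

lemma sat_Alls:
  "sat S Z (Alls r \<phi>) \<longleftrightarrow> (\<forall>ws\<in>tuples (univ S) r. sat S (assign Z ws) \<phi>)"
proof (induction r arbitrary: \<phi>)
  case 0
  then show ?case by (simp add: Alls_def assign_def)
next
  case (Suc r)
  \<comment> \<open>The innermost quantifier is absorbed into the body, which is why the induction
    generalises over the formula.\<close>
  have "sat S Z (Alls (Suc r) \<phi>) \<longleftrightarrow> sat S Z (Alls r (All r \<phi>))"
    by (simp add: Alls_def)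
  also have "\<dots> \<longleftrightarrow> (\<forall>ws\<in>tuples (univ S) r. \<forall>a\<in>univ S. sat S ((assign Z ws)(r := a)) \<phi>)"
    by (simp add: Suc.IH)
  also have "\<dots> \<longleftrightarrow> (\<forall>ws\<in>tuples (univ S) r. \<forall>a\<in>univ S. sat S (assign Z (ws @ [a])) \<phi>)"
    by (auto simp: assign_snoc tuples_def)
  also have "\<dots> \<longleftrightarrow> (\<forall>ws\<in>tuples (univ S) (Suc r). sat S (assign Z ws) \<phi>)"
    unfolding tuples_Suc by blast
  finally show ?case .
qed

text \<open>Pushing a negation through the quantifier prefix reduces this to the universal
  case.\<close>

lemma sat_Exs:
  "sat S Z (Exs r \<phi>) \<longleftrightarrow> (\<exists>ws\<in>tuples (univ S) r. sat S (assign Z ws) \<phi>)"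
proof -
  have "sat S Z (Neg (Exs r \<phi>)) \<longleftrightarrow> sat S Z (Alls r (Neg \<phi>))"
  proof -
    have "sat S Z (Neg (foldr Ex vs \<phi>)) \<longleftrightarrow> sat S Z (foldr All vs (Neg \<phi>))" for vs
      by (induction vs arbitrary: Z) auto
    then show ?thesis
      by (simp add: Exs_def Alls_def)
  qed
  then show ?thesis
    unfolding sat_Alls by auto
qed

section \<open>Canonical abstraction\<close>

lemma two_valued_eq_TV0:
  assumes "two_valued N" "us \<in> tuples (univ N) (arity p)"
  shows "interp N p us = TV0 \<longleftrightarrow> interp N p us \<noteq> TV1"
proof -
  have "interp N p us \<in> {TV0, TV1}"
    using assms PiE_mem unfolding two_valued_def by metis
  then show ?thesis
    by auto
qed

text \<open>Only three nonempty sets of definite values exist, and \<open>join\<close> separates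
  them. So an abstract value determines exactly which values occur among the concrete
  tuples.\<close>

lemma join_eq_iff:
  assumes "X \<noteq> {}" "X \<subseteq> {TV0, TV1}"
  shows "join X = v \<longleftrightarrow>
    (case v of TV0 \<Rightarrow> X = {TV0} | TV1 \<Rightarrow> X = {TV1} | TVhalf \<Rightarrow> X = {TV0, TV1})"
proof -
  have "X = {TV0} \<or> X = {TV1} \<or> X = {TV0, TV1}"
    using assms by auto
  moreover have "\<not> is_singleton {TV0, TV1}"
    by (simp add: is_singleton_def doubleton_eq_iff)
  ultimately show ?thesis
    by (auto simp: join_def doubleton_eq_iff split: tv.split)
qed

text \<open>The set whose join is the abstract value at \<open>us'\<close>. It is named because the
  formula speaks about its elements, not about the join.\<close>

definition fiber_values :: "('p::vocabulary, 'u) struct \<Rightarrow> 'p \<Rightarrow> 'p cname list \<Rightarrow> tv set" where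
  "fiber_values N p us' =
     {interp N p us | us. us \<in> tuples (univ N) (arity p) \<and> map (canon_name N) us = us'}"

lemma fiber_values_subset:
  "two_valued N \<Longrightarrow> fiber_values N p us' \<subseteq> {TV0, TV1}"
  unfolding fiber_values_def using two_valued_eq_TV0 by blast

text \<open>Every abstract node has a preimage. This excludes the empty set, on which
  \<open>join\<close> defaults to \<open>TVhalf\<close>.\<close>

lemma fiber_values_nonempty:
  assumes "us' \<in> tuples (canon_name N ` univ N) (arity p)"
  shows "fiber_values N p us' \<noteq> {}"
proof -
  have "us' \<in> lists (canon_name N ` univ N)"
    using assms by (auto simp: tuples_def)
  then obtain us where "us' = map (canon_name N) us" "set us \<subseteq> univ N"
    unfolding lists_image by auto
  then show ?thesis
    using assms by (auto simp: fiber_values_def tuples_def)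
qed

lemma univ_canon_abs [simp]: "univ (canon_abs N) = canon_name N ` univ N"
  by (simp add: canon_abs_def)

lemma interp_canon_abs:
  "us' \<in> tuples (canon_name N ` univ N) (arity p) \<Longrightarrow>
    interp (canon_abs N) p us' = join (fiber_values N p us')"
  by (simp add: canon_abs_def fiber_values_def)

lemma interp_canon_abs_eq_iff:
  assumes "two_valued N" "us' \<in> tuples (canon_name N ` univ N) (arity p)"
  shows "interp (canon_abs N) p us' = v \<longleftrightarrow>
    (case v of TV0 \<Rightarrow> fiber_values N p us' = {TV0} | TV1 \<Rightarrow> fiber_values N p us' = {TV1}
      | TVhalf \<Rightarrow> fiber_values N p us' = {TV0, TV1})"
  using join_eq_iff[OF fiber_values_nonempty[OF assms(2)] fiber_values_subset[OF assms(1)]]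
    interp_canon_abs[OF assms(2)] by simp

lemma canon_abs_eq_iff:
  "canon_abs N = canon_abs M \<longleftrightarrow> canon_name N ` univ N = canon_name M ` univ M \<and>
    (\<forall>p. \<forall>us\<in>tuples (canon_name M ` univ M) (arity p).
      interp (canon_abs N) p us = interp (canon_abs M) p us)"
  (is "?l \<longleftrightarrow> ?r")
proof
  assume ?l
  then show ?r
    by (metis univ_canon_abs)
next
  assume r: ?r
  \<comment> \<open>Outside the tuples both interpretations are \<open>undefined\<close>, since
    equal node sets give equal domains of restriction.\<close>
  have "interp (canon_abs N) p us = interp (canon_abs M) p us" for p us
    using r by (cases "us \<in> tuples (canon_name M ` univ M) (arity p)") (auto simp: canon_abs_def)
  then show ?l
    using r by (intro struct.equality) auto
qed

section \<open>Canonical names and predicates of arity at most one\<close>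

lemma preds_1_tuples: "u \<in> univ N \<Longrightarrow> p \<in> preds 1 \<Longrightarrow> [u] \<in> tuples (univ N) (arity p)"
  by (simp add: tuples_def preds_def)

lemma canon_name_eq_iff:
  assumes "two_valued N" "two_valued M" "u \<in> univ N" "v \<in> univ M"
  shows "canon_name N u = canon_name M v \<longleftrightarrow> (\<forall>p\<in>preds 1. interp N p [u] = interp M p [v])"
proof -
  have "interp N p [u] = interp M p [v] \<longleftrightarrow>
      (interp N p [u] = TV1 \<longleftrightarrow> interp M p [v] = TV1) \<and>
      (interp N p [u] = TV0 \<longleftrightarrow> interp M p [v] = TV0)" if "p \<in> preds 1" for p
    using two_valued_eq_TV0[OF assms(1) preds_1_tuples[OF assms(3) that]]
      two_valued_eq_TV0[OF assms(2) preds_1_tuples[OF assms(4) that]] by auto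
  then show ?thesis
    unfolding canon_name_def by blast
qed

text \<open>Nodes with the same name agree on all unary predicates, so the join runs over a
  singleton.\<close>

lemma interp_canon_abs_unary:
  assumes "two_valued N" "u \<in> univ N" "p \<in> preds 1"
  shows "interp (canon_abs N) p [canon_name N u] = interp N p [u]"
proof -
  have same: "interp N p [v] = interp N p [u]"
    if "v \<in> univ N" "canon_name N v = canon_name N u" for v
    using that assms canon_name_eq_iff[of N N v u] by blast
  have "fiber_values N p [canon_name N u] = {interp N p [u]}"
  proof
    show "fiber_values N p [canon_name N u] \<subseteq> {interp N p [u]}"
      using same by (auto simp: fiber_values_def tuples_def map_eq_Cons_conv)
    show "{interp N p [u]} \<subseteq> fiber_values N p [canon_name N u]"
      using preds_1_tuples[OF assms(2,3)] by (fastforce simp: fiber_values_def)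
  qed
  then show ?thesis
    using assms by (subst interp_canon_abs) (auto simp: tuples_def preds_def join_def)
qed

lemma interp_canon_abs_nullary:
  assumes "p \<in> preds 0"
  shows "interp (canon_abs N) p [] = interp N p []"
proof -
  have "fiber_values N p [] = {interp N p []}"
    using assms by (auto simp: fiber_values_def preds_def)
  then show ?thesis
    using assms by (subst interp_canon_abs) (auto simp: preds_def join_def)
qed

text \<open>At arity 0 or 1 the abstract value is a value of \<open>M\<close> itself, hence
  definite.\<close>

lemma canon_abs_half_arity:
  assumes "two_valued M" "us \<in> tuples (canon_name M ` univ M) (arity p)"
    "interp (canon_abs M) p us = TVhalf"
  shows "arity p \<ge> 2"
proof (rule ccontr)
  assume "\<not> arity p \<ge> 2"
  then consider "arity p = 0" | "arity p = 1" by linarith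
  then show False
  proof cases
    case 1
    then show False
      using assms interp_canon_abs_nullary[of p M] two_valued_eq_TV0[OF assms(1), of "[]" p]
      by (auto simp: preds_def)
  next
    case 2
    then obtain u where "us = [canon_name M u]" "u \<in> univ M"
      using assms(2) by (auto simp: tuples_def length_Suc_conv)
    then show False
      using 2 assms interp_canon_abs_unary[of M u p] two_valued_eq_TV0[OF assms(1), of "[u]" p]
      by (auto simp: preds_def tuples_def)
  qed
qed

section \<open>Meaning of the characteristic formula\<close>

definition agrees :: "tv \<Rightarrow> tv \<Rightarrow> bool" where
  "agrees a b \<longleftrightarrow> b = TVhalf \<or> a = b"

lemma sat_lit:
  assumes "two_valued N" "map Z vs \<in> tuples (univ N) (arity p)"
  shows "sat N Z (lit p b vs) \<longleftrightarrow> agrees (interp N p (map Z vs)) b"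
  using two_valued_eq_TV0[OF assms] by (cases b) (auto simp: agrees_def)

lemma sat_node_fm:
  assumes "two_valued N" "two_valued M" "Z w \<in> univ N" "u \<in> canon_name M ` univ M"
  shows "sat N Z (node_fm (canon_abs M) u w) \<longleftrightarrow> canon_name N (Z w) = u"
proof -
  obtain v where v: "v \<in> univ M" "u = canon_name M v"
    using assms(4) by auto
  have "sat N Z (lit p (interp (canon_abs M) p [u]) [w]) \<longleftrightarrow> interp N p [Z w] = interp M p [v]"
    if p: "p \<in> preds 1" for p
  proof -
    \<comment> \<open>Definiteness keeps the literal from degenerating to \<open>TrueF\<close>, so
      that agreement becomes equality of values.\<close>
    have "interp M p [v] \<noteq> TVhalf"
      using two_valued_eq_TV0[OF assms(2) preds_1_tuples[OF v(1) p]] by auto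
    then show ?thesis
      using sat_lit[OF assms(1), of Z "[w]" p] preds_1_tuples[OF assms(3) p]
        interp_canon_abs_unary[OF assms(2) v(1) p] v(2)
      by (auto simp: agrees_def)
  qed
  then show ?thesis
    using canon_name_eq_iff[OF assms(1,2,3) v(1)] v(2)
    by (simp add: node_fm_def sat_BigConj)
qed

lemma sat_nodes_fm:
  assumes "two_valued N" "two_valued M" "ws \<in> tuples (univ N) r"
    "us \<in> tuples (canon_name M ` univ M) r"
  shows "sat N (assign Z ws) (nodes_fm (canon_abs M) us) \<longleftrightarrow> map (canon_name N) ws = us"
proof -
  have len: "length ws = r" "length us = r"
    using assms by (auto simp: tuples_def)
  have "sat N (assign Z ws) (node_fm (canon_abs M) (us ! j) j) \<longleftrightarrow> canon_name N (ws ! j) = us ! j"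
    if "j < r" for j
  proof -
    have "ws ! j \<in> univ N" "us ! j \<in> canon_name M ` univ M"
      using that assms(3,4) len unfolding tuples_def by (auto dest: nth_mem)
    moreover have "assign Z ws j = ws ! j"
      using that len by (simp add: assign_def)
    ultimately show ?thesis
      using sat_node_fm[OF assms(1,2), of "assign Z ws" j "us ! j"] by simp
  qed
  then show ?thesis
    using len by (auto simp: nodes_fm_def sat_BigConj list_eq_iff_nth_eq)
qed

section \<open>Evaluation of the formulas \<open>xi\<close> and \<open>tau\<close>\<close>

lemma finite_canon_names: "finite (X :: 'p::vocabulary cname set)"
  by (rule finite_subset[OF subset_UNIV]) (simp add: finite_Prod_UNIV)

lemma arity_le_maxR: "arity (p :: 'p::vocabulary) \<le> maxR TYPE('p)"
  by (simp add: maxR_def)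

lemma all_preds_upto_maxR:
  "(\<forall>r\<in>{k..maxR TYPE('p)}. \<forall>p\<in>preds r. P r p) \<longleftrightarrow>
    (\<forall>p::'p::vocabulary. k \<le> arity p \<longrightarrow> P (arity p) p)"
  using arity_le_maxR[where 'p = 'p] by (auto simp: preds_def)

lemma map_canon_name_tuples:
  "ws \<in> tuples (univ N) r \<Longrightarrow> map (canon_name N) ws \<in> tuples (canon_name N ` univ N) r"
  by (auto simp: tuples_def)

text \<open>Each implication in \<open>xi\<close> concerns the concrete tuples over one abstract
  tuple and bounds their values by the abstract one. Only agreement results: nothing yet forces a
  value \<open>TVhalf\<close> to be attained as a proper join.\<close>

lemma sat_xi:
  assumes "two_valued N" "two_valued M"
  shows "sat N Z (xi (canon_abs M)) \<longleftrightarrow> canon_name N ` univ N = canon_name M ` univ M \<and>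
    (\<forall>p. \<forall>ws\<in>tuples (univ N) (arity p).
      agrees (interp N p ws) (interp (canon_abs M) p (map (canon_name N) ws)))"
  (is "_ \<longleftrightarrow> ?img = _ \<and> ?vals")
proof -
  let ?S = "canon_abs M"
  let ?ag = "\<lambda>p ws. agrees (interp N p ws) (interp ?S p (map (canon_name N) ws))"
  \<comment> \<open>Names over a finite vocabulary are finite in number even when \<open>M\<close>
    is infinite, so the big conjunctions range over finite index sets.\<close>
  note fin = finite_canon_names finite_tuples[OF finite_canon_names]
  have 1: "sat N Z (BigConj (univ ?S) (\<lambda>u. Ex 0 (node_fm ?S u 0))) \<longleftrightarrow> univ ?S \<subseteq> ?img"
  proof -
    have "sat N Z (Ex 0 (node_fm ?S u 0)) \<longleftrightarrow> u \<in> ?img" if "u \<in> univ ?S" for u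
      using sat_node_fm[OF assms, of "Z(0 := _)" 0 u] that by (auto simp: image_iff eq_commute)
    then show ?thesis
      by (simp only: sat_BigConj fin) blast
  qed
  have 2: "sat N Z (All 0 (BigDisj (univ ?S) (\<lambda>u. node_fm ?S u 0))) \<longleftrightarrow> ?img \<subseteq> univ ?S"
  proof -
    have "sat N (Z(0 := a)) (BigDisj (univ ?S) (\<lambda>u. node_fm ?S u 0)) \<longleftrightarrow> canon_name N a \<in> univ ?S"
      if "a \<in> univ N" for a
      using sat_node_fm[OF assms, of "Z(0 := a)" 0] that by (simp only: sat_BigDisj fin) auto
    then show ?thesis by auto
  qed
  have 3: "sat N Z (BigConj (preds 0) (\<lambda>p. lit p (interp ?S p []) [])) \<longleftrightarrow>
      (\<forall>p\<in>preds 0. \<forall>ws\<in>tuples (univ N) (arity p). ?ag p ws)"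
    using sat_lit[OF assms(1), of Z "[]"] by (auto simp: sat_BigConj preds_def)
  \<comment> \<open>Equality of the node sets ensures that the name tuple of every concrete tuple
    occurs as an index, so exactly one implication has a true premise.\<close>
  have 4: "sat N Z (BigConj {1..maxR TYPE('a)} (\<lambda>r. BigConj (preds r) (\<lambda>p.
             Alls r (BigConj (tuples (univ ?S) r) (\<lambda>us.
               Imp (nodes_fm ?S us) (lit p (interp ?S p us) [0..<r])))))) \<longleftrightarrow>
      (\<forall>p. 1 \<le> arity p \<longrightarrow> (\<forall>ws\<in>tuples (univ N) (arity p). ?ag p ws))"
    if img: "?img = univ ?S"
  proof -
    have "sat N (assign Z ws) (BigConj (tuples (univ ?S) (arity p)) (\<lambda>us.
               Imp (nodes_fm ?S us) (lit p (interp ?S p us) [0..<arity p]))) \<longleftrightarrow> ?ag p ws"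
      if ws: "ws \<in> tuples (univ N) (arity p)" for p ws
    proof -
      have len: "length ws = arity p" using ws by (simp add: tuples_def)
      have "map (canon_name N) ws \<in> tuples (univ ?S) (arity p)"
        using map_canon_name_tuples[OF ws] img by simp
      then show ?thesis
        using sat_nodes_fm[OF assms ws] sat_lit[OF assms(1), of "assign Z ws" "[0..<arity p]" p]
          ws len by (auto simp: sat_BigConj fin)
    qed
    then show ?thesis
      by (simp add: sat_BigConj sat_Alls all_preds_upto_maxR del: One_nat_def)
  qed
  have 5: "?vals \<longleftrightarrow> (\<forall>p\<in>preds 0. \<forall>ws\<in>tuples (univ N) (arity p). ?ag p ws) \<and>
      (\<forall>p. 1 \<le> arity p \<longrightarrow> (\<forall>ws\<in>tuples (univ N) (arity p). ?ag p ws))"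
  proof -
    have "arity p = 0 \<or> 1 \<le> arity p" for p :: 'a by linarith
    then show ?thesis unfolding preds_def by blast
  qed
  show ?thesis
    unfolding xi_def sat.simps(5) 1 2 3 5 using 4 by auto
qed

text \<open>The node formulas confine the witnesses to the fiber over \<open>us\<close>; the
  positive and the negative witness then supply the values \<open>TV1\<close> and
  \<open>TV0\<close>.\<close>

lemma sat_tau_pred:
  assumes "two_valued N" "two_valued M"
  shows "sat N Z (tau_pred (canon_abs M) p) \<longleftrightarrow>
    (\<forall>us\<in>tuples (canon_name M ` univ M) (arity p). interp (canon_abs M) p us = TVhalf \<longrightarrow>
      {TV0, TV1} \<subseteq> fiber_values N p us)"
proof -
  let ?S = "canon_abs M"
  have "sat N Z (Exs (arity p) (Conj (nodes_fm ?S us) (Atom p [0..<arity p]))) \<longleftrightarrow>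
          TV1 \<in> fiber_values N p us"
       "sat N Z (Exs (arity p) (Conj (nodes_fm ?S us) (Neg (Atom p [0..<arity p])))) \<longleftrightarrow>
          TV0 \<in> fiber_values N p us"
    if us: "us \<in> tuples (canon_name M ` univ M) (arity p)" for us
  proof -
    have ws: "map (assign Z ws) [0..<arity p] = ws" if "ws \<in> tuples (univ N) (arity p)" for ws
      using that by (simp add: tuples_def)
    show "sat N Z (Exs (arity p) (Conj (nodes_fm ?S us) (Atom p [0..<arity p]))) \<longleftrightarrow>
          TV1 \<in> fiber_values N p us"
      using sat_nodes_fm[OF assms _ us] ws
      by (auto simp: sat_Exs fiber_values_def simp del: map_assign) metis+
    show "sat N Z (Exs (arity p) (Conj (nodes_fm ?S us) (Neg (Atom p [0..<arity p])))) \<longleftrightarrow>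
          TV0 \<in> fiber_values N p us"
      using sat_nodes_fm[OF assms _ us] ws two_valued_eq_TV0[OF assms(1), of _ p]
      by (auto simp: sat_Exs fiber_values_def simp del: map_assign) metis+
  qed
  moreover have "finite {us \<in> tuples (univ ?S) (arity p). interp ?S p us = TVhalf}"
    by (simp add: finite_tuples[OF finite_canon_names])
  ultimately show ?thesis
    by (simp add: tau_pred_def Let_def sat_BigConj) blast
qed

lemma sat_tau:
  assumes "two_valued N" "two_valued M"
  shows "sat N Z (tau (canon_abs M)) \<longleftrightarrow> canon_abs N = canon_abs M"
proof (cases "canon_name N ` univ N = canon_name M ` univ M")
  case False
  then show ?thesis
    using sat_xi[OF assms] by (auto simp: tau_def canon_abs_eq_iff)
next
  case img: True
  let ?S = "canon_abs M"
  \<comment> \<open>The concrete tuples are regrouped by their name tuples.\<close>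
  have vals: "(\<forall>ws\<in>tuples (univ N) (arity p). agrees (interp N p ws) (interp ?S p (map (canon_name N) ws)))
      \<longleftrightarrow> (\<forall>us\<in>tuples (canon_name M ` univ M) (arity p). \<forall>x\<in>fiber_values N p us. agrees x (interp ?S p us))"
    for p
    using map_canon_name_tuples[of _ N "arity p"] unfolding img fiber_values_def by blast
  \<comment> \<open>The bound on the arity disappears because no value \<open>TVhalf\<close> occurs
    below arity 2.\<close>
  have halves: "(\<forall>p. 2 \<le> arity p \<longrightarrow> sat N Z (tau_pred ?S p)) \<longleftrightarrow>
     (\<forall>p. \<forall>us\<in>tuples (canon_name M ` univ M) (arity p). interp ?S p us = TVhalf \<longrightarrow>
      {TV0, TV1} \<subseteq> fiber_values N p us)"
    using canon_abs_half_arity[OF assms(2)] unfolding sat_tau_pred[OF assms] by blast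
  \<comment> \<open>For a definite abstract value, agreement and nonemptiness make the fiber values
    the matching singleton. For \<open>TVhalf\<close>, agreement is vacuous and the second conjunct
    supplies both values.\<close>
  have key: "(\<forall>x\<in>fiber_values N p us. agrees x (interp ?S p us)) \<and>
      (interp ?S p us = TVhalf \<longrightarrow> {TV0, TV1} \<subseteq> fiber_values N p us) \<longleftrightarrow>
      interp (canon_abs N) p us = interp ?S p us"
    if "us \<in> tuples (canon_name M ` univ M) (arity p)" for p us
    using fiber_values_nonempty[of us N p] fiber_values_subset[OF assms(1), of p us]
      interp_canon_abs_eq_iff[OF assms(1), of us p "interp ?S p us"] that
    unfolding img by (auto simp: agrees_def split: tv.splits)
  have "sat N Z (tau ?S) \<longleftrightarrow> sat N Z (xi ?S) \<and> (\<forall>p. 2 \<le> arity p \<longrightarrow> sat N Z (tau_pred ?S p))"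
    by (simp add: tau_def sat_BigConj all_preds_upto_maxR)
  also have "\<dots> \<longleftrightarrow> (\<forall>p. \<forall>us\<in>tuples (canon_name M ` univ M) (arity p).
      interp (canon_abs N) p us = interp ?S p us)"
    unfolding sat_xi[OF assms] halves vals using img by (simp add: key[symmetric] ball_conj_distrib) blast
  finally show ?thesis
    using img by (simp add: canon_abs_eq_iff)
qed

theorem theorem2:
  fixes F :: "'p::vocabulary fm"
    and S :: "('p, 'p cname) struct"
    and N :: "('p, 'u) struct"
  assumes "closed_fm F"
    and "three_valued S"
    and "ICA TYPE('v) S"
    and "two_valued N"
  shows "N \<in> gamma_c F {S} \<longleftrightarrow> N \<Turnstile> gamma_hat F S"
proof -
  \<comment> \<open>\<open>M\<close> merely witnesses that \<open>S\<close> is an abstraction; its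
    node type is independent of that of \<open>N\<close>.\<close>
  obtain M :: "('p, 'v) struct" where M: "two_valued M" "S = canon_abs M"
    using assms(3) unfolding ICA_def by blast
  show ?thesis
    \<comment> \<open>Satisfaction of \<open>tau\<close> does not depend on the assignment, so the
      quantifier over assignments in \<open>models\<close> passes to \<open>F\<close> alone.\<close>
    using assms(4) unfolding M(2)
    by (simp add: gamma_c_def gamma_hat_def models_def sat_tau[OF assms(4) M(1)])
qed

end
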